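(* Let $n\ge1$. For any $\mathbf{a}=(a_1,\dots,a_n)\in\mathbb{Z}^n$, there exists a natural number $N$ with $2N\le 2^{n+1}-2$ such that: (i) $F(m,\mathbf{a})\bmod 2$ is $2N$-periodic for $m\ge 2N+1$, i.e. $F(m+2N,\mathbf{a})\equiv F(m,\mathbf{a})\bmod 2$ for all $m\geq 2N+1$; (ii) if, in addition, $a_n$ is odd, then $F(m,\mathbf{a})\bmod 2$ is $2N$-periodic for $m\in\mathbb{N}$, i.e. $F(m+2N,\mathbf{a})\equiv F(m,\mathbf{a})\bmod 2$ for all $m\in\mathbb{N}$.
   Context: $\mathbb{N}=\{1,2,3,\dots\}$. For $k\in\mathbb{N}$, $\mathcal{P}(k)$ is the set of distinct prime factors of $k$. Given $\mathbf{a}=(a_1,\dots,a_n)\in\mathbb{Z}^n$, let $\theta_1,\dots,\theta_n$ be the roots (with multiplicity, in $\mathbb{C}$) of $X^n-a_1X^{n-1}+a_2X^{n-2}-\dots+(-1)^na_n$ (so $a_i$ is the $i$-th elementary symmetric function of the roots), and define $$F(m,\mathbf{a}):=\sum_{j\mid m}(-1)^j\,\frac{\sum_{i=1}^n\theta_i^j}{j}\prod_{p\in\mathcal{P}(m/j)}\Big(1-\frac1p\Big).$$ It is known that $F(m,\mathbf{a})\in\mathbb{Z}$ for all $m\in\mathbb{N}$. *)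

theory Defs
  imports Complex_Main "HOL-Computational_Algebra.Computational_Algebra"
    "HOL-Number_Theory.Cong"
begin

(* An integer vector (a_1, ..., a_n) is a function a :: nat => int of which only the values
   a 1, ..., a n are used. *)
definition root_poly :: "nat \<Rightarrow> (nat \<Rightarrow> int) \<Rightarrow> complex poly" where
  "root_poly n a = monom 1 n + (\<Sum>i=1..n. monom ((-1) ^ i * of_int (a i)) (n - i))"

(* The multiset of roots counts each theta with its multiplicity. *)
definition F :: "nat \<Rightarrow> (nat \<Rightarrow> int) \<Rightarrow> nat \<Rightarrow> complex" where
  "F n a m =
     (\<Sum>j | j dvd m. (-1) ^ j * ((\<Sum>\<theta>\<in>#proots (root_poly n a). \<theta> ^ j) / of_nat j)
        * (\<Prod>p\<in>prime_factors (m div j). 1 - 1 / of_nat p))"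

(* Since F is complex-valued by definition, its congruences are stated between integers that
   are equal to its values; in particular the relation fails for non-integral values. *)
definition complex_int_cong :: "complex \<Rightarrow> complex \<Rightarrow> int \<Rightarrow> bool" where
  "complex_int_cong x y M \<longleftrightarrow> (\<exists>u v::int. x = of_int u \<and> y = of_int v \<and> [u = v] (mod M))"

lemma complex_int_cong_of_int [simp]:
  "complex_int_cong (of_int u) (of_int v) M \<longleftrightarrow> [u = v] (mod M)"
  by (auto simp: complex_int_cong_def)

end

theory Submission
  imports Defs "HOL-Number_Theory.Totient" "HOL-Library.Z2"
begin

text \<open>Put \<open>Q = 1 + a\<^sub>1 X + \<dots> + a\<^sub>n X\<^sup>n\<close>, the product of the factors \<open>1 + \<theta> X\<close> over the roots \<open>\<theta>\<close>.
The coefficients of \<open>- X Q' / Q\<close> are the signed power sums \<open>(-1)\<^sup>j \<Sum> \<theta>\<^sup>j\<close>, so \<open>F(m)\<close> is a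
linear function of a logarithmic derivative of \<open>Q\<close>. As a function of a power series \<open>Q\<close> with
constant term 1, it therefore turns products into sums, and it depends only on the coefficients of
\<open>Q\<close> up to degree \<open>m\<close>. On \<open>Q = 1 - X\<^sup>d\<close> it takes the value 1 if \<open>d\<close> divides \<open>m\<close> and 0
otherwise, because the totients of the divisors of a number add up to that number. Up to any given
degree, an integral power series with constant term 1 is a finite product of integer powers of the
series \<open>1 - X\<^sup>d\<close>; hence \<open>F(m)\<close> is always an integer.

The parity of \<open>F(m)\<close> is found by exhibiting a second function of \<open>Q\<close> with the same properties.
Since \<open>Q(X)\<^sup>2\<close> and \<open>Q(X\<^sup>2)\<close> agree modulo 2, the series \<open>E(Q) = (Q(X)\<^sup>2 - Q(X\<^sup>2)) / 2\<close> is
integral, and modulo 2 the quotient \<open>E(Q) / Q\<^sup>2\<close> also turns products into sums. Its coefficient at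
\<open>X\<^sup>m\<close> for \<open>Q = 1 - X\<^sup>d\<close> is again 1 if \<open>d\<close> divides \<open>m\<close> and 0 otherwise. So \<open>E(Q) / Q\<^sup>2\<close>
is the generating function of the \<open>F(m)\<close>, \<open>m > 0\<close>, modulo 2 (\<open>integral_with_parity_all\<close>).

For the polynomial \<open>Q\<close> this is a rational function over the field with two elements. Let \<open>r\<close> be
the degree of \<open>Q\<close> modulo 2. For \<open>r > 0\<close> the powers of \<open>X\<close> are nonzero residues modulo \<open>Q\<close>, of
which there are only \<open>2\<^sup>r - 1\<close>, so \<open>Q\<close> divides some \<open>X\<^sup>d - 1\<close> with
\<open>1 \<le> d \<le> max 1 (2\<^sup>r - 1)\<close> (\<open>dvd_X_power_minus_1\<close>). If \<open>N\<close> is a multiple of \<open>d\<close>, then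
\<open>Q\<^sup>2\<close> divides \<open>(X\<^sup>N - 1)\<^sup>2 = X\<^bsup>2N\<^esup> - 1\<close> modulo 2, and multiplying the generating function by
\<open>X\<^bsup>2N\<^esup> - 1\<close> gives a polynomial of degree at most \<open>2n + 2(N - r)\<close>. Thus \<open>F\<close> modulo 2 has
period \<open>2N\<close> beyond \<open>2(n - r)\<close> (\<open>parity_log_periodic\<close>). The choice \<open>N = d * max 1 (n - r)\<close> makes
this threshold at most \<open>2N\<close> and respects the bound on \<open>N\<close>; if \<open>a\<^sub>n\<close> is odd, then \<open>r = n\<close>
and the threshold is 0.\<close>

section \<open>Reduction of integral power series\<close>

\<comment> \<open>The sums and products of bits below are those of a field, not bit operations.\<close>
declare add_bit_eq_xor [simp del] mult_bit_eq_and [simp del]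

definition of_int_fps :: "int fps \<Rightarrow> 'a::comm_ring_1 fps" where
  "of_int_fps f = Abs_fps (\<lambda>k. of_int (f $ k))"

lemma of_int_fps_nth [simp]: "of_int_fps f $ k = of_int (f $ k)"
  by (simp add: of_int_fps_def)

lemma of_int_fps_1 [simp]: "of_int_fps 1 = 1"
  by (rule fps_ext) simp

lemma of_int_fps_add: "of_int_fps (f + g) = of_int_fps f + of_int_fps g"
  by (rule fps_ext) simp

lemma of_int_fps_mult: "of_int_fps (f * g) = of_int_fps f * of_int_fps g"
  by (rule fps_ext) (simp add: fps_mult_nth)

lemma of_int_fps_power: "of_int_fps (f ^ k) = of_int_fps f ^ k"
  by (induction k) (simp_all add: of_int_fps_mult)

lemma of_int_bit: "(of_int x :: bit) = of_bool (odd x)"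
  by (cases "even x") (auto elim!: evenE oddE)

section \<open>A multiplicative-to-additive invariant modulo 2\<close>

lemma fps_nth_compose_X2:
  "(f oo fps_X ^ 2 :: 'a::comm_ring_1 fps) $ k = (if even k then f $ (k div 2) else 0)"
proof -
  have "(f oo fps_X ^ 2) $ k = (\<Sum>i=0..k. if i * 2 = k then f $ i else 0)"
    by (auto simp: fps_compose_nth fps_X_power_nth simp flip: power_mult intro!: sum.cong)
  also have "\<dots> = (\<Sum>i\<in>{0..k} \<inter> {i. i * 2 = k}. f $ i)"
    by (simp add: sum.inter_restrict)
  also have "{0..k} \<inter> {i. i * 2 = k} = (if even k then {k div 2} else {})"
    by auto
  finally show ?thesis by simp
qed

text \<open>The reflection \<open>i \<mapsto> k - i\<close> pairs equal terms, leaving only its fixed point.\<close>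
lemma sum_symmetric_parity:
  fixes g :: "nat \<Rightarrow> int"
  assumes "\<And>i. i \<le> k \<Longrightarrow> g (k - i) = g i"
  shows "even ((\<Sum>i=0..k. g i) - (if even k then g (k div 2) else 0))"
proof -
  define A B where "A = {i. 2 * i < k}" and "B = {i. i \<le> k \<and> 2 * i > k}"
  have fin: "finite A" "finite B"
    by (rule finite_subset[of _ "{0..k}"]; auto simp: A_def B_def)+
  have "{0..k} = A \<union> B \<union> (if even k then {k div 2} else {})"
    unfolding set_eq_iff A_def B_def by (cases "even k"; simp; presburger)
  hence "(\<Sum>i=0..k. g i) = sum g (A \<union> B) + (if even k then g (k div 2) else 0)"
    using fin by (auto simp: A_def B_def)
  also have "sum g (A \<union> B) = sum g A + sum g B"
    using fin by (intro sum.union_disjoint) (auto simp: A_def B_def)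
  also have "sum g B = sum g A"
    by (rule sum.reindex_bij_witness[of _ "\<lambda>i. k - i" "\<lambda>i. k - i"])
       (auto simp: A_def B_def assms)
  finally show ?thesis by simp
qed

text \<open>The integer division is exact by \<open>even_square_defect\<close>.\<close>
definition half_defect :: "int fps \<Rightarrow> int fps" where
  "half_defect Q = Abs_fps (\<lambda>k. ((Q ^ 2) $ k - (Q oo fps_X ^ 2) $ k) div 2)"

text \<open>The square of \<open>Q\<close> is a symmetric convolution, so modulo 2 only the middle term
\<open>q\<^sup>2 \<equiv> q\<close> survives.\<close>
lemma even_square_defect: "even ((Q ^ 2 :: int fps) $ k - (Q oo fps_X ^ 2) $ k)"
proof -
  have "(Q ^ 2) $ k = (\<Sum>i=0..k. Q $ i * Q $ (k - i))"
    by (simp add: power2_eq_square fps_mult_nth)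
  moreover have "even (\<dots> - (if even k then Q $ (k div 2) * Q $ (k - k div 2) else 0))"
    by (rule sum_symmetric_parity) (auto simp: mult.commute)
  moreover have "even ((if even k then Q $ (k div 2) * Q $ (k - k div 2) else 0)
      - (Q oo fps_X ^ 2) $ k)"
    by (auto simp: fps_nth_compose_X2)
  ultimately show ?thesis by presburger
qed

lemma half_defect: "2 * half_defect Q = Q ^ 2 - (Q oo fps_X ^ 2)"
proof (rule fps_ext)
  fix k
  have "2 * (((Q ^ 2) $ k - (Q oo fps_X ^ 2) $ k) div 2) = (Q ^ 2) $ k - (Q oo fps_X ^ 2) $ k"
    using even_square_defect[of Q k] by (rule dvd_mult_div_cancel)
  thus "(2 * half_defect Q) $ k = (Q ^ 2 - (Q oo fps_X ^ 2)) $ k"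
    by (simp add: half_defect_def numeral_fps_const)
qed

text \<open>Halving \<open>P\<^sup>2 Q\<^sup>2 - P(X\<^sup>2) Q(X\<^sup>2)\<close> gives a product rule that becomes a Leibniz rule modulo 2,
where \<open>P(X\<^sup>2) = P\<^sup>2\<close>; dividing by the square, as in \<open>parity_log\<close> below, makes it additive.\<close>
lemma half_defect_mult:
  "half_defect (P * Q) = half_defect P * Q ^ 2 + (P oo fps_X ^ 2) * half_defect Q"
proof -
  have "2 * half_defect (P * Q) = P ^ 2 * Q ^ 2 - (P oo fps_X ^ 2) * (Q oo fps_X ^ 2)"
    by (simp add: half_defect fps_compose_mult_distrib power_mult_distrib)
  also have "\<dots> = (P ^ 2 - (P oo fps_X ^ 2)) * Q ^ 2 + (P oo fps_X ^ 2) * (Q ^ 2 - (Q oo fps_X ^ 2))"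
    by (simp only: left_diff_distrib right_diff_distrib) simp
  also have "\<dots> = 2 * (half_defect P * Q ^ 2 + (P oo fps_X ^ 2) * half_defect Q)"
    unfolding half_defect[symmetric] by (simp only: distrib_left mult.assoc mult.left_commute)
  finally have "2 * half_defect (P * Q) = 2 * (half_defect P * Q ^ 2 + (P oo fps_X ^ 2) * half_defect Q)" .
  moreover have "(2 :: int fps) \<noteq> 0"
    by (simp add: numeral_fps_const)
  ultimately show ?thesis by (metis mult_left_cancel)
qed

lemma of_int_fps_bit_frobenius: "(of_int_fps (Q oo fps_X ^ 2) :: bit fps) = of_int_fps Q ^ 2"
proof (rule fps_ext)
  fix k
  have "(of_int_fps (Q oo fps_X ^ 2) :: bit fps) $ k = of_int_fps (Q ^ 2) $ k"
    using even_square_defect[of Q k] by (auto simp: of_int_bit)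
  thus "(of_int_fps (Q oo fps_X ^ 2) :: bit fps) $ k = (of_int_fps Q ^ 2) $ k"
    by (simp add: of_int_fps_power)
qed

definition parity_log :: "int fps \<Rightarrow> bit fps" where
  "parity_log Q = of_int_fps (half_defect Q) * inverse (of_int_fps Q ^ 2)"

lemma parity_log_mult:
  assumes "P $ 0 = 1" "Q $ 0 = 1"
  shows "parity_log (P * Q) = parity_log P + parity_log Q"
proof -
  let ?p = "of_int_fps P :: bit fps" and ?q = "of_int_fps Q :: bit fps"
  have 1: "?p ^ 2 * inverse (?p ^ 2) = 1" "?q ^ 2 * inverse (?q ^ 2) = 1"
    using assms by (auto intro!: inverse_mult_eq_1' simp: fps_nth_power_0)
  have "parity_log (P * Q) = (of_int_fps (half_defect P) * ?q ^ 2 + ?p ^ 2 * of_int_fps (half_defect Q))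
      * (inverse (?p ^ 2) * inverse (?q ^ 2))"
    by (simp add: parity_log_def half_defect_mult of_int_fps_add of_int_fps_mult of_int_fps_power
      of_int_fps_bit_frobenius power_mult_distrib fps_inverse_mult)
  also have "\<dots> = parity_log P * (?q ^ 2 * inverse (?q ^ 2)) + parity_log Q * (?p ^ 2 * inverse (?p ^ 2))"
    by (simp add: parity_log_def algebra_simps)
  finally show ?thesis by (simp add: 1)
qed

section \<open>Power sums as a logarithmic derivative\<close>

text \<open>For \<open>Q = \<Prod> (1 + \<theta> X)\<close> the \<open>j\<close>-th coefficient, \<open>j > 0\<close>, is \<open>\<Sum> (-\<theta>)\<^sup>j\<close>
(\<open>log_power_sums_prod_roots\<close>).\<close>
definition log_power_sums :: "'a::field fps \<Rightarrow> 'a fps" where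
  "log_power_sums Q = - (fps_X * fps_deriv Q * inverse Q)"

lemma log_power_sums_mult:
  fixes P Q :: "'a::field fps"
  assumes "P $ 0 \<noteq> 0" "Q $ 0 \<noteq> 0"
  shows "log_power_sums (P * Q) = log_power_sums P + log_power_sums Q"
proof -
  have 1: "P * inverse P = 1" "Q * inverse Q = 1"
    using assms by (auto intro!: inverse_mult_eq_1')
  have "log_power_sums (P * Q) =
      - (fps_X * fps_deriv P * inverse P * (Q * inverse Q)
        + fps_X * fps_deriv Q * inverse Q * (P * inverse P))"
    by (simp add: log_power_sums_def fps_inverse_mult algebra_simps)
  thus ?thesis by (simp add: 1 log_power_sums_def)
qed

lemma fps_geometric:
  assumes "d \<ge> 1"
  shows "(1 - fps_X ^ d) * Abs_fps (\<lambda>k. if d dvd k then 1 else 0) = (1 :: 'a::comm_ring_1 fps)"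
  using assms
  by (intro fps_ext) (auto simp: left_diff_distrib fps_X_power_mult_nth dvd_minus_self
    dest: dvd_imp_le)

lemma fps_X_power_geometric:
  fixes d :: nat
  assumes "d \<ge> 1"
  shows "fps_X ^ d * inverse (1 - fps_X ^ d :: 'a::field fps) =
    Abs_fps (\<lambda>k. if d dvd k \<and> k > 0 then 1 else 0)"
proof -
  have "inverse (1 - fps_X ^ d :: 'a fps) = Abs_fps (\<lambda>k. if d dvd k then 1 else 0)"
    by (rule fps_inverse_unique) (rule fps_geometric[OF assms])
  thus ?thesis
    using assms by (intro fps_ext) (auto simp: fps_X_power_mult_nth dvd_minus_self dest: dvd_imp_le)
qed

lemma log_power_sums_one_minus_X_power:
  assumes "d \<ge> 1"
  shows "log_power_sums (1 - fps_X ^ d :: 'a::field fps) $ k = (if d dvd k \<and> k > 0 then of_nat d else 0)"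
proof -
  have "fps_X * fps_deriv (1 - fps_X ^ d :: 'a fps) = - (fps_const (of_nat d) * fps_X ^ d)"
    using assms by (intro fps_ext) (auto simp: fps_X_power_nth)
  hence "log_power_sums (1 - fps_X ^ d :: 'a fps) =
      fps_const (of_nat d) * (fps_X ^ d * inverse (1 - fps_X ^ d))"
    by (simp add: log_power_sums_def mult.assoc)
  thus ?thesis by (simp add: fps_X_power_geometric[OF assms])
qed

section \<open>The weighted divisor sum\<close>

text \<open>As the product over the primes is \<open>\<phi>(m/j) / (m/j)\<close>, this is the mean
\<open>(1/m) \<Sum>\<^bsub>j | m\<^esub> \<phi>(m/j) S\<^sub>j\<close>; for \<open>S\<^sub>j = c\<^sup>j\<close> it counts the necklaces of length \<open>m\<close>
in \<open>c\<close> colours.\<close>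
definition necklace_mean :: "complex fps \<Rightarrow> nat \<Rightarrow> complex" where
  "necklace_mean S m =
     (\<Sum>j | j dvd m. S $ j / of_nat j * (\<Prod>p\<in>prime_factors (m div j). 1 - 1 / of_nat p))"

lemma necklace_mean_add: "necklace_mean (S + T) m = necklace_mean S m + necklace_mean T m"
  by (simp add: necklace_mean_def add_divide_distrib distrib_right sum.distrib)

text \<open>After clearing denominators this is \<open>\<Sum>\<^bsub>k | e\<^esub> \<phi>(e/k) = e\<close>.\<close>
lemma sum_divisors_totient_weight:
  assumes "e > 0"
  shows "(\<Sum>k | k dvd e. 1 / of_nat k * (\<Prod>p\<in>prime_factors (e div k). 1 - 1 / of_nat p)) = (1 :: complex)"
proof -
  have weight: "(\<Prod>p\<in>prime_factors x. 1 - 1 / of_nat p) = (of_nat (totient x) / of_nat x :: complex)"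
    if "x > 0" for x :: nat
  proof -
    have "(\<Prod>p\<in>prime_factors x. 1 - 1 / of_nat p :: complex)
        = of_real (\<Prod>p\<in>prime_factors x. 1 - 1 / real p)"
      by simp
    also have "(\<Prod>p\<in>prime_factors x. 1 - 1 / real p) = real (totient x) / real x"
      using that by (simp add: totient_formula2)
    finally show ?thesis by simp
  qed
  have "(\<Sum>k | k dvd e. 1 / of_nat k * (\<Prod>p\<in>prime_factors (e div k). 1 - 1 / of_nat p))
      = (\<Sum>k | k dvd e. of_nat (totient (e div k)) / of_nat e :: complex)"
  proof (rule sum.cong)
    fix k assume "k \<in> {k. k dvd e}"
    then obtain l where l: "e = k * l" by auto
    with assms have "k > 0" "l > 0" by auto
    thus "1 / of_nat k * (\<Prod>p\<in>prime_factors (e div k). 1 - 1 / of_nat p)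
        = (of_nat (totient (e div k)) / of_nat e :: complex)"
      by (simp add: l weight)
  qed simp
  also have "\<dots> = (\<Sum>k | k dvd e. of_nat (totient k) / of_nat e)"
    by (rule sum.reindex_bij_witness[of _ "\<lambda>k. e div k" "\<lambda>k. e div k"])
       (use assms in \<open>auto simp: div_dvd_iff_mult\<close>)
  also have "\<dots> = of_nat (\<Sum>k | k dvd e. totient k) / of_nat e"
    by (simp add: sum_divide_distrib)
  finally show ?thesis using assms by (simp add: totient_divisor_sum)
qed

text \<open>Only the multiples \<open>j = d k\<close> of \<open>d\<close> contribute, and \<open>k\<close> runs over the divisors of \<open>m/d\<close>.\<close>
lemma necklace_mean_one_minus_X_power:
  assumes "d \<ge> 1" "m \<ge> 1"
  shows "necklace_mean (log_power_sums (1 - fps_X ^ d)) m = of_bool (d dvd m)"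
proof (cases "d dvd m")
  case True
  then obtain e where e: "m = d * e" by auto
  have pos: "d > 0" "e > 0" using assms e by auto
  have "necklace_mean (log_power_sums (1 - fps_X ^ d)) m =
      (\<Sum>j | j dvd m \<and> d dvd j. of_nat d / of_nat j * (\<Prod>p\<in>prime_factors (m div j). 1 - 1 / of_nat p))"
    unfolding necklace_mean_def
    by (rule sum.mono_neutral_cong_right)
       (use assms in \<open>auto simp: log_power_sums_one_minus_X_power dest: dvd_pos_nat\<close>)
  also have "\<dots> = (\<Sum>k | k dvd e. 1 / of_nat k * (\<Prod>p\<in>prime_factors (e div k). 1 - 1 / of_nat p))"
    by (rule sum.reindex_bij_witness[of _ "\<lambda>k. d * k" "\<lambda>j. j div d"]) (use pos e in auto)
  finally show ?thesis using sum_divisors_totient_weight[OF pos(2)] True by simp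
next
  case False
  hence "\<not> d dvd j" if "j dvd m" for j using that dvd_trans by blast
  thus ?thesis using False assms
    by (auto simp: necklace_mean_def log_power_sums_one_minus_X_power intro!: sum.neutral)
qed

lemma of_int_fps_one_minus_X_power [simp]: "of_int_fps (1 - fps_X ^ d) = 1 - fps_X ^ d"
  by (rule fps_ext) simp

lemma of_int_fps_X_power: "of_int_fps (fps_X ^ d) = fps_X ^ d"
  by (rule fps_ext) (simp add: fps_X_power_nth)

lemma of_int_fps_uminus: "of_int_fps (- f) = - of_int_fps f"
  by (rule fps_ext) simp

text \<open>Here \<open>E(1 - X\<^sup>d) = - X\<^sup>d (1 - X\<^sup>d)\<close>, so the quotient by the square is the geometric series
\<open>X\<^sup>d / (1 - X\<^sup>d)\<close> modulo 2.\<close>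
lemma parity_log_one_minus_X_power:
  assumes "d \<ge> 1" "m \<ge> 1"
  shows "parity_log (1 - fps_X ^ d) $ m = of_bool (d dvd m)"
proof -
  let ?P = "1 - fps_X ^ d :: bit fps"
  have "2 * half_defect (1 - fps_X ^ d) = 2 * (- (fps_X ^ d * (1 - fps_X ^ d)))"
    by (simp add: half_defect fps_compose_sub_distrib fps_compose_power[symmetric]
      power2_eq_square algebra_simps flip: power_mult)
  moreover have "(2 :: int fps) \<noteq> 0"
    by (simp add: numeral_fps_const)
  ultimately have "half_defect (1 - fps_X ^ d) = - (fps_X ^ d * (1 - fps_X ^ d))"
    by (metis mult_left_cancel)
  hence "of_int_fps (half_defect (1 - fps_X ^ d)) = - (fps_X ^ d * ?P)"
    by (simp only: of_int_fps_uminus of_int_fps_mult of_int_fps_one_minus_X_power)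
       (simp add: of_int_fps_X_power)
  hence "parity_log (1 - fps_X ^ d) = - (fps_X ^ d * inverse ?P * (?P * inverse ?P))"
    by (simp add: parity_log_def power2_eq_square fps_inverse_mult mult_ac)
  also have "?P * inverse ?P = 1"
    using assms by (intro inverse_mult_eq_1') simp
  finally show ?thesis
    using assms by (simp add: fps_X_power_geometric)
qed

section \<open>Integrality and parity of the divisor sum\<close>

definition integral_with_parity :: "int fps \<Rightarrow> nat \<Rightarrow> bool" where
  "integral_with_parity Q m \<longleftrightarrow>
     (\<exists>f::int. necklace_mean (log_power_sums (of_int_fps Q)) m = of_int f \<and> of_int f = parity_log Q $ m)"

text \<open>Both sides of the comparison are additive in the series, so it may be transported across a factor
for which it holds, in either direction.\<close>
lemma integral_with_parity_cancel:
  assumes "P $ 0 = 1" "Q $ 0 = 1" "integral_with_parity P m"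
  shows "integral_with_parity (P * Q) m \<longleftrightarrow> integral_with_parity Q m"
proof -
  have S: "necklace_mean (log_power_sums (of_int_fps (P * Q))) m =
      necklace_mean (log_power_sums (of_int_fps P)) m + necklace_mean (log_power_sums (of_int_fps Q)) m"
    using assms by (simp add: of_int_fps_mult log_power_sums_mult necklace_mean_add)
  have L: "parity_log (P * Q) $ m = parity_log P $ m + parity_log Q $ m"
    using assms by (simp add: parity_log_mult)
  obtain f where f: "necklace_mean (log_power_sums (of_int_fps P)) m = of_int f" "of_int f = parity_log P $ m"
    using assms by (auto simp: integral_with_parity_def)
  show ?thesis
  proof
    assume "integral_with_parity (P * Q) m"
    then obtain g where g: "necklace_mean (log_power_sums (of_int_fps (P * Q))) m = of_int g"
      "of_int g = parity_log (P * Q) $ m"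
      by (auto simp: integral_with_parity_def)
    show "integral_with_parity Q m"
      unfolding integral_with_parity_def
      by (rule exI[of _ "g - f"]) (metis S L f g add_diff_cancel_left' of_int_diff)
  next
    assume "integral_with_parity Q m"
    then obtain g where g: "necklace_mean (log_power_sums (of_int_fps Q)) m = of_int g"
      "of_int g = parity_log Q $ m"
      by (auto simp: integral_with_parity_def)
    show "integral_with_parity (P * Q) m"
      unfolding integral_with_parity_def
      by (rule exI[of _ "f + g"]) (metis S L f g of_int_add)
  qed
qed

lemma integral_with_parity_one_minus_X_power:
  assumes "d \<ge> 1" "m \<ge> 1"
  shows "integral_with_parity (1 - fps_X ^ d) m"
  unfolding integral_with_parity_def
  by (rule exI[of _ "of_bool (d dvd m)"])
     (use assms in \<open>simp add: necklace_mean_one_minus_X_power parity_log_one_minus_X_power\<close>)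

text \<open>Both sides depend on the coefficients of \<open>Q\<close> up to degree \<open>m\<close> only, and vanish for \<open>Q = 1\<close>.\<close>
lemma integral_with_parity_of_trivial:
  assumes "m \<ge> 1" "Q $ 0 = 1" "\<And>k. 1 \<le> k \<Longrightarrow> k \<le> m \<Longrightarrow> Q $ k = 0"
  shows "integral_with_parity Q m"
proof -
  have "(fps_X * fps_deriv (of_int_fps Q :: complex fps)) $ k = 0" if "k \<le> m" for k
    using that assms by (cases k) auto
  hence "log_power_sums (of_int_fps Q :: complex fps) $ j = 0" if "j \<le> m" for j
    using that by (simp add: log_power_sums_def fps_mult_nth[of "fps_X * _"])
  hence S: "necklace_mean (log_power_sums (of_int_fps Q)) m = 0"
    using assms by (auto simp: necklace_mean_def dest!: dvd_imp_le intro!: sum.neutral)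
  have "half_defect Q $ k = 0" if "k \<le> m" for k
  proof (cases "k = 0")
    case True
    thus ?thesis using assms by (simp add: half_defect_def fps_nth_compose_X2 fps_nth_power_0)
  next
    case False
    have "(Q ^ 2) $ k = (\<Sum>i=0..k. Q $ i * Q $ (k - i))"
      by (simp add: power2_eq_square fps_mult_nth)
    also have "\<dots> = 0"
    proof (rule sum.neutral, rule ballI)
      fix i assume "i \<in> {0..k}"
      thus "Q $ i * Q $ (k - i) = 0"
        using assms(3)[of i] assms(3)[of "k - i"] that False by (cases "i = 0") auto
    qed
    finally show ?thesis
      using False assms(3)[of "k div 2"] that
      by (auto simp: half_defect_def fps_nth_compose_X2 elim!: evenE)
  qed
  hence L: "parity_log Q $ m = 0"
    by (simp add: parity_log_def fps_mult_nth[of "of_int_fps _"])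
  show ?thesis
    unfolding integral_with_parity_def by (rule exI[of _ 0]) (simp add: S L)
qed

text \<open>The factors \<open>1 - X\<^sup>d\<close> are split off one at a time. The descending induction on \<open>d\<close> treats the
series \<open>1 + c X\<^sup>d + \<dots>\<close>, and the inner induction on \<open>c\<close> moves \<open>c\<close> to 0 by multiplying by
\<open>1 - X\<^sup>d\<close> when \<open>c > 0\<close> and dividing by it when \<open>c < 0\<close>.\<close>
lemma integral_with_parity_all:
  assumes "m \<ge> 1" "Q $ 0 = 1"
  shows "integral_with_parity Q m"
proof -
  have "1 \<le> m + 1" by simp
  hence "\<forall>Q. Q $ 0 = 1 \<longrightarrow> (\<forall>k. 0 < k \<longrightarrow> k < 1 \<longrightarrow> Q $ k = 0) \<longrightarrow> integral_with_parity Q m"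
  proof (induction rule: inc_induct)
    case base
    thus ?case using assms(1) by (auto intro!: integral_with_parity_of_trivial)
  next
    case (step d)
    let ?P = "1 - fps_X ^ d :: int fps"
    have P: "?P $ 0 = 1" "integral_with_parity ?P m"
      using step.hyps assms(1) integral_with_parity_one_minus_X_power by auto
    have "\<forall>Q. Q $ 0 = 1 \<longrightarrow> (\<forall>k. 0 < k \<longrightarrow> k < d \<longrightarrow> Q $ k = 0) \<longrightarrow> Q $ d = c \<longrightarrow> integral_with_parity Q m"
      for c :: int
    proof (induction c rule: int_induct[where k = 0])
      case base
      thus ?case using step.IH less_Suc_eq by metis
    next
      case (step1 c)
      show ?case
      proof (intro allI impI)
        fix Q :: "int fps"
        assume Q: "Q $ 0 = 1" "\<forall>k. 0 < k \<longrightarrow> k < d \<longrightarrow> Q $ k = 0" "Q $ d = c + 1"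
        have coeff: "(?P * Q) $ k = Q $ k - (if k < d then 0 else Q $ (k - d))" for k
          by (simp add: left_diff_distrib fps_X_power_mult_nth)
        have "integral_with_parity (?P * Q) m"
          using step.hyps Q by (intro step1.IH[rule_format]) (auto simp: coeff)
        thus "integral_with_parity Q m"
          using integral_with_parity_cancel[OF P(1) Q(1) P(2)] by simp
      qed
    next
      case (step2 c)
      show ?case
      proof (intro allI impI)
        fix Q :: "int fps"
        assume Q: "Q $ 0 = 1" "\<forall>k. 0 < k \<longrightarrow> k < d \<longrightarrow> Q $ k = 0" "Q $ d = c - 1"
        define R where "R = Abs_fps (\<lambda>k. if d dvd k then 1 else 0) * Q"
        have PR: "?P * R = Q"
          using fps_geometric[of d, where 'a = int] step.hyps by (simp add: R_def flip: mult.assoc)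
        have coeff: "R $ k = Q $ k + (if k < d then 0 else R $ (k - d))" for k
          by (subst PR[symmetric]) (simp add: left_diff_distrib fps_X_power_mult_nth)
        have R0: "R $ 0 = 1" using coeff[of 0] step.hyps Q by simp
        have "integral_with_parity R m"
        proof (intro step2.IH[rule_format] R0)
          show "R $ d = c" using coeff[of d] R0 Q by simp
          show "R $ k = 0" if "0 < k" "k < d" for k using coeff[of k] that Q by simp
        qed
        thus "integral_with_parity Q m"
          using integral_with_parity_cancel[OF P(1) R0 P(2)] by (simp add: PR)
      qed
    qed
    thus ?case by blast
  qed
  thus ?thesis using assms by auto
qed

section \<open>Periodicity of the invariant modulo 2\<close>

text \<open>Writing \<open>q = 1 + X s\<close> gives \<open>u = q u - s (X u)\<close>, so a factor \<open>X\<close> can be cancelled.\<close>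
lemma dvd_X_power_mult_cancel:
  fixes q u :: "'a::comm_ring_1 poly"
  assumes "coeff q 0 = 1" "q dvd monom 1 i * u"
  shows "q dvd u"
  using assms(2)
proof (induction i)
  case (Suc i)
  obtain s where s: "q = pCons 1 s" using assms(1) by (cases q) auto
  have "q dvd pCons 0 (monom 1 i * u)"
    using Suc.prems by (simp add: monom_Suc)
  hence "q dvd q * (monom 1 i * u) - s * pCons 0 (monom 1 i * u)"
    by (intro dvd_diff dvd_triv_left dvd_mult)
  also have "q * (monom 1 i * u) - s * pCons 0 (monom 1 i * u) = monom 1 i * u"
    by (simp add: s)
  finally show ?case by (rule Suc.IH)
qed simp

text \<open>For positive degree \<open>r\<close>, the residues of the powers of \<open>X\<close> modulo \<open>q\<close> are nonzero polynomials of
degree below \<open>r\<close>. Over two elements such a polynomial is determined by its nonempty support, so two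
of the first \<open>2\<^sup>r\<close> powers agree modulo \<open>q\<close>; cancelling the smaller one leaves \<open>X\<^sup>d - 1\<close>.\<close>
lemma dvd_X_power_minus_1:
  fixes q :: "bit poly"
  assumes "coeff q 0 = 1"
  shows "\<exists>d. d \<ge> 1 \<and> d \<le> max 1 (2 ^ degree q - 1) \<and> q dvd monom 1 d - 1"
proof (cases "degree q = 0")
  case True
  then obtain c where "q = [:c:]" by (rule degree_eq_zeroE)
  with assms show ?thesis by (intro exI[of _ 1]) (auto simp flip: one_pCons)
next
  case False
  define r where "r = degree q"
  define supp where "supp i = {k. coeff (monom 1 i mod q) k \<noteq> 0}" for i
  have q: "q \<noteq> 0" using assms by auto
  have "supp i \<in> Pow {..<r} - {{}}" for i
  proof -
    have "monom 1 i mod q \<noteq> 0"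
    proof
      assume "monom 1 i mod q = 0"
      hence "q dvd monom 1 i * 1" by (simp add: mod_eq_0_iff_dvd)
      hence "q dvd 1" by (rule dvd_X_power_mult_cancel[OF assms])
      thus False using False q by (simp add: is_unit_iff_degree)
    qed
    moreover from this have "degree (monom 1 i mod q) < r"
      using degree_mod_less[OF q] by (auto simp: r_def)
    hence "coeff (monom 1 i mod q) k = 0" if "k \<ge> r" for k
      using that by (intro coeff_eq_0) auto
    ultimately show ?thesis
      by (force simp: supp_def poly_eq_iff not_less[symmetric])
  qed
  hence "supp ` {..<2 ^ r} \<subseteq> Pow {..<r} - {{}}" by blast
  hence "card (supp ` {..<2 ^ r}) \<le> card (Pow {..<r} - {{}})"
    by (intro card_mono) auto
  also have "\<dots> < card {..<(2::nat) ^ r}"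
    by (simp add: card_Pow card_Diff_subset)
  finally have "\<not> inj_on supp {..<2 ^ r}" by (rule pigeonhole)
  then obtain i j where ij: "i < j" "j < 2 ^ r" "supp i = supp j"
    by (metis (no_types, lifting) inj_onI lessThan_iff linorder_neqE_nat)
  have "monom 1 i mod q = monom 1 j mod q"
  proof (rule poly_eqI)
    fix k
    have "coeff (monom 1 i mod q) k \<noteq> 0 \<longleftrightarrow> coeff (monom 1 j mod q) k \<noteq> 0"
      using ij(3) by (auto simp: supp_def)
    thus "coeff (monom 1 i mod q) k = coeff (monom 1 j mod q) k" by (metis bit_not_zero_iff)
  qed
  hence "q dvd monom 1 j - monom 1 i" by (metis mod_eq_dvd_iff)
  also have "monom 1 j - monom 1 i = monom 1 i * (monom 1 (j - i) - 1 :: bit poly)"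
    using ij(1) by (simp add: right_diff_distrib mult_monom)
  finally have "q dvd monom 1 (j - i) - 1" by (rule dvd_X_power_mult_cancel[OF assms])
  thus ?thesis using ij by (intro exI[of _ "j - i"]) (auto simp: r_def)
qed

lemma half_defect_nth_eq_0:
  assumes "degree P \<le> n" "k > 2 * n"
  shows "half_defect (fps_of_poly P) $ k = 0"
proof -
  have "(fps_of_poly P ^ 2) $ k = coeff (P ^ 2) k"
    by (simp add: fps_of_poly_power[symmetric])
  also have "\<dots> = 0"
    using assms degree_power_le[of P 2] by (intro coeff_eq_0) auto
  finally show ?thesis
    using assms by (auto simp: half_defect_def fps_nth_compose_X2 coeff_eq_0 elim!: evenE)
qed

text \<open>Let \<open>X\<^sup>N - 1 = q R\<close>. Over two elements \<open>(X\<^sup>N - 1)\<^sup>2 = X\<^bsup>2N\<^esup> - 1\<close>, so multiplying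
\<open>E / q\<^sup>2\<close> by \<open>X\<^bsup>2N\<^esup> - 1\<close> gives \<open>E R\<^sup>2\<close>, a polynomial of degree at most
\<open>2n + 2(N - deg q)\<close>. The vanishing of its coefficient at \<open>m + 2N\<close> is the claim.\<close>
lemma parity_log_periodic:
  fixes P :: "int poly"
  defines "q \<equiv> map_poly of_int P :: bit poly"
  assumes "coeff P 0 = 1" "degree P \<le> n" "q dvd monom 1 N - 1" "N \<ge> 1" "m > 2 * (n - degree q)"
  shows "parity_log (fps_of_poly P) $ (m + 2 * N) = parity_log (fps_of_poly P) $ m"
proof -
  let ?l = "parity_log (fps_of_poly P)"
  have q: "of_int_fps (fps_of_poly P) = fps_of_poly q"
    by (rule fps_ext) (simp add: q_def coeff_map_poly)
  obtain R where R: "monom 1 N - 1 = q * R" using assms(4) by blast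
  have ne: "monom 1 N - 1 \<noteq> (0 :: bit poly)"
    using assms(5) by (auto simp: poly_eq_iff intro!: exI[of _ N])
  have "degree (q * R) \<le> N"
    unfolding R[symmetric] by (intro degree_diff_le) (auto simp: degree_monom_le)
  hence dR: "degree q + degree R \<le> N"
    using ne R by (subst (asm) degree_mult_eq) auto
  have "degree (R ^ 2) \<le> degree R * 2" by (rule degree_power_le)
  hence R2: "coeff (R ^ 2) k = 0" if "k > 2 * (N - degree q)" for k
    using that dR by (intro coeff_eq_0) auto
  have "fps_of_poly q $ 0 = (1 :: bit)" using assms(2) by (simp add: q_def coeff_map_poly)
  hence unit: "inverse (fps_of_poly q ^ 2) * fps_of_poly q ^ 2 = 1"
    by (intro inverse_mult_eq_1) (simp add: fps_nth_power_0)
  have "(fps_X ^ N - 1 :: bit fps) = fps_of_poly (q * R)"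
    by (simp add: R[symmetric] fps_of_poly_diff fps_of_poly_monom')
  hence "?l * (fps_X ^ N - 1) ^ 2 = of_int_fps (half_defect (fps_of_poly P)) *
      (inverse (fps_of_poly q ^ 2) * fps_of_poly q ^ 2) * fps_of_poly (R ^ 2)"
    by (simp add: parity_log_def q fps_of_poly_mult fps_of_poly_power power_mult_distrib mult_ac)
  also have "(fps_X ^ N - 1 :: bit fps) ^ 2 = fps_X ^ (2 * N) - 1"
  proof -
    have "(x - 1) ^ 2 = x ^ 2 - 1 + 2 * (1 - x)" for x :: "bit fps"
      by algebra
    moreover have "(2 :: bit fps) = 0" by (simp add: numeral_fps_const)
    ultimately have "(fps_X ^ N - 1 :: bit fps) ^ 2 = (fps_X ^ N) ^ 2 - 1" by (metis mult_zero_left add_0_right)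
    thus ?thesis by (simp only: power_mult[symmetric] mult.commute)
  qed
  finally have "(?l * (fps_X ^ (2 * N) - 1)) $ (m + 2 * N) =
      (of_int_fps (half_defect (fps_of_poly P)) * fps_of_poly (R ^ 2)) $ (m + 2 * N)"
    by (simp add: unit)
  also have "\<dots> = 0"
    unfolding fps_mult_nth
  proof (rule sum.neutral, rule ballI)
    fix i assume i: "i \<in> {0..m + 2 * N}"
    show "of_int_fps (half_defect (fps_of_poly P)) $ i * fps_of_poly (R ^ 2) $ (m + 2 * N - i) = 0"
    proof (cases "i > 2 * n")
      case True
      thus ?thesis using half_defect_nth_eq_0[OF assms(3)] by simp
    next
      case False
      thus ?thesis using assms(6) dR by (simp add: R2)
    qed
  qed
  finally have "?l $ m + ?l $ (m + 2 * N) = 0"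
    by (simp add: right_diff_distrib fps_X_power_mult_right_nth)
  thus ?thesis by (cases "?l $ m"; cases "?l $ (m + 2 * N)") simp_all
qed

section \<open>The characteristic polynomial\<close>

lemma log_power_sums_linear:
  fixes c :: "'a::field"
  shows "log_power_sums (1 + fps_const c * fps_X) = Abs_fps (\<lambda>j. if j = 0 then 0 else (- c) ^ j)"
proof -
  let ?L = "Abs_fps (\<lambda>j. if j = 0 then 0 else (- c) ^ j)" and ?Q = "1 + fps_const c * fps_X"
  have "?L * ?Q = - (fps_const c * fps_X)"
  proof (rule fps_ext)
    fix k
    show "(?L * ?Q) $ k = (- (fps_const c * fps_X)) $ k"
      by (cases k; cases "k - 1") (auto simp: distrib_left mult.left_commute[of _ "fps_const c"])
  qed
  hence "?L * ?Q * inverse ?Q = - (fps_const c * fps_X) * inverse ?Q" by simp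
  moreover have "?Q * inverse ?Q = 1" by (rule inverse_mult_eq_1') simp
  ultimately show ?thesis by (simp add: log_power_sums_def mult.assoc mult.commute[of fps_X])
qed

text \<open>Reversing the coefficients and substituting \<open>-X\<close> turns each factor \<open>X - \<theta>\<close> into
\<open>1 + \<theta> X\<close>, also for \<open>\<theta> = 0\<close>.\<close>
lemma log_power_sums_prod_roots:
  fixes M :: "'a::field multiset"
  defines "G \<equiv> fps_of_poly (pcompose (reflect_poly (\<Prod>\<theta>\<in>#M. [:-\<theta>, 1:])) (monom (-1) 1))"
  shows "G $ 0 = 1 \<and> log_power_sums G = Abs_fps (\<lambda>j. if j = 0 then 0 else (-1) ^ j * (\<Sum>\<theta>\<in>#M. \<theta> ^ j))"
  unfolding G_def
proof (induction M)
  case empty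
  show ?case by (simp add: log_power_sums_def fps_eq_iff pcompose_1)
next
  case (add \<theta> M)
  let ?G = "fps_of_poly (pcompose (reflect_poly (\<Prod>\<theta>\<in>#M. [:-\<theta>, 1:])) (monom (-1) 1))"
  have lin: "fps_of_poly (pcompose (reflect_poly [:-\<theta>, 1:]) (monom (-1) 1)) = 1 + fps_const \<theta> * fps_X"
    by (rule fps_ext) (auto simp: coeff_reflect_poly coeff_pCons le_Suc_eq split: nat.splits)
  have G: "fps_of_poly (pcompose (reflect_poly (\<Prod>\<theta>\<in>#add_mset \<theta> M. [:-\<theta>, 1:])) (monom (-1) 1))
      = (1 + fps_const \<theta> * fps_X) * ?G"
    by (simp only: image_mset_add_mset prod_mset.add_mset reflect_poly_mult pcompose_mult
      fps_of_poly_mult lin)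
  have IH: "?G $ 0 = 1"
    "log_power_sums ?G = Abs_fps (\<lambda>j. if j = 0 then 0 else (-1) ^ j * (\<Sum>\<theta>\<in>#M. \<theta> ^ j))"
    using add.IH by auto
  have "log_power_sums ((1 + fps_const \<theta> * fps_X) * ?G)
      = log_power_sums (1 + fps_const \<theta> * fps_X) + log_power_sums ?G"
    by (rule log_power_sums_mult) (use IH(1) in simp_all)
  also have "\<dots> = Abs_fps (\<lambda>j. if j = 0 then 0 else (-1) ^ j * (\<Sum>\<theta>\<in>#add_mset \<theta> M. \<theta> ^ j))"
    unfolding IH(2) log_power_sums_linear
    by (rule fps_ext) (simp add: distrib_left power_minus[of \<theta>])
  finally show ?case
    unfolding G using IH(1) by (simp del: fps_of_poly_nth)
qed

definition char_poly_rev :: "nat \<Rightarrow> (nat \<Rightarrow> int) \<Rightarrow> int poly" where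
  "char_poly_rev n a = 1 + (\<Sum>i=1..n. monom (a i) i)"

lemma coeff_char_poly_rev:
  "coeff (char_poly_rev n a) k = (if k = 0 then 1 else if k \<le> n then a k else 0)"
  by (auto simp: char_poly_rev_def coeff_sum)

lemma coeff_root_poly:
  "coeff (root_poly n a) k =
     (if k = n then 1 else if k < n then (-1) ^ (n - k) * of_int (a (n - k)) else 0)"
proof -
  have "(\<Sum>i=1..n. coeff (monom ((-1) ^ i * complex_of_int (a i)) (n - i)) k) =
      (\<Sum>i\<in>{1..n} \<inter> {i. n - i = k}. (-1) ^ i * complex_of_int (a i))"
    by (subst sum.inter_restrict) (auto intro!: sum.cong)
  also have "{1..n} \<inter> {i. n - i = k} = (if k < n then {n - k} else {})"
    by auto
  finally show ?thesis by (auto simp: root_poly_def coeff_sum)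
qed

lemma degree_root_poly: "degree (root_poly n a) = n"
  by (rule antisym[OF degree_le le_degree]) (auto simp: coeff_root_poly)

text \<open>The integral polynomial \<open>1 + a\<^sub>1 X + \<dots> + a\<^sub>n X\<^sup>n\<close> is \<open>\<Prod> (1 + \<theta> X)\<close>, as the
reversal and the substitution of \<open>-X\<close> cancel the signs \<open>(-1)\<^sup>i\<close> of \<open>root_poly\<close>.\<close>
lemma F_eq_necklace_mean:
  assumes "m \<ge> 1"
  shows "F n a m = necklace_mean (log_power_sums (of_int_fps (fps_of_poly (char_poly_rev n a)))) m"
proof -
  let ?r = "root_poly n a"
  have "of_int_fps (fps_of_poly (char_poly_rev n a))
      = fps_of_poly (pcompose (reflect_poly ?r) (monom (-1) 1))"
    by (rule fps_ext)
       (auto simp: coeff_char_poly_rev coeff_reflect_poly degree_root_poly coeff_root_poly)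
  moreover have "(\<Prod>\<theta>\<in>#proots ?r. [:-\<theta>, 1:]) = ?r"
    using complex_poly_decompose_multiset[of ?r] by (simp add: degree_root_poly coeff_root_poly)
  ultimately have "log_power_sums (of_int_fps (fps_of_poly (char_poly_rev n a))) =
      Abs_fps (\<lambda>j. if j = 0 then 0 else (-1) ^ j * (\<Sum>\<theta>\<in>#proots ?r. \<theta> ^ j))"
    using log_power_sums_prod_roots[of "proots ?r"] by simp
  thus ?thesis
    using assms by (auto simp: F_def necklace_mean_def intro!: sum.cong)
qed

lemma F_eq_of_int:
  assumes "m \<ge> 1"
  shows "\<exists>f::int. F n a m = of_int f \<and> of_int f = parity_log (fps_of_poly (char_poly_rev n a)) $ m"
  using integral_with_parity_all[OF assms, of "fps_of_poly (char_poly_rev n a)"]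
  by (simp add: integral_with_parity_def F_eq_necklace_mean[OF assms] coeff_char_poly_rev)

section \<open>Periodicity of \<open>F\<close> modulo 2\<close>

theorem theorem2p2:
  fixes n :: nat and a :: "nat \<Rightarrow> int"
  assumes "n \<ge> 1"
  shows "\<exists>N::nat. N \<ge> 1 \<and> 2 * N \<le> 2 ^ (n + 1) - 2 \<and>
           (\<forall>m\<ge>2 * N + 1. complex_int_cong (F n a (m + 2 * N)) (F n a m) 2) \<and>
           (odd (a n) \<longrightarrow> (\<forall>m\<ge>1. complex_int_cong (F n a (m + 2 * N)) (F n a m) 2))"
proof -
  define P where "P = char_poly_rev n a"
  define q where "q = (map_poly of_int P :: bit poly)"
  define r where "r = degree q"
  have coeff_q: "coeff q k = of_int (coeff P k)" for k
    by (simp add: q_def coeff_map_poly)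
  have degP: "degree P \<le> n"
    by (rule degree_le) (simp add: P_def coeff_char_poly_rev)
  have r: "r \<le> n"
    unfolding r_def by (rule degree_le) (use degP in \<open>auto simp: coeff_q coeff_eq_0\<close>)
  have P0: "coeff P 0 = 1" by (simp add: P_def coeff_char_poly_rev)
  obtain d where d: "d \<ge> 1" "d \<le> max 1 (2 ^ r - 1)" "q dvd monom 1 d - 1"
    using dvd_X_power_minus_1[of q] P0 by (auto simp: coeff_q r_def)
  define t where "t = max 1 (n - r)"
  define N where "N = d * t"
  have "N \<ge> 1" using d by (simp add: N_def t_def)
  have "n - r \<le> t" by (simp add: t_def)
  also have "t \<le> N" using d by (simp add: N_def)
  finally have "n - r \<le> N" .
  \<comment> \<open>For \<open>0 < r < n\<close> this is \<open>(2\<^sup>r - 1) t \<le> (2\<^sup>r - 1) 2\<^sup>t = 2\<^sup>n - 2\<^sup>t\<close>.\<close>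
  have bound: "N \<le> 2 ^ n - 1"
  proof (cases "r = n")
    case True
    have "(2::nat) ^ 1 \<le> 2 ^ n" using assms by (intro power_increasing) auto
    thus ?thesis using True d(2) by (simp add: N_def t_def)
  next
    case False
    hence t: "t = n - r" using r by (simp add: t_def)
    have lt: "t < 2 ^ t" by (rule less_exp)
    show ?thesis
    proof (cases "r = 0")
      case True
      hence "N = t" "t = n" using d t by (simp_all add: N_def)
      thus ?thesis using less_exp[of n] by linarith
    next
      case r0: False
      have "(2::nat) ^ 1 \<le> 2 ^ r" using r0 by (intro power_increasing) auto
      hence "N \<le> (2 ^ r - 1) * 2 ^ t"
        unfolding N_def using d(2) lt by (intro mult_le_mono) auto
      also have "\<dots> = 2 ^ n - 2 ^ t"
        using r by (simp add: t diff_mult_distrib flip: power_add)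
      also have "\<dots> \<le> 2 ^ n - 1" by (intro diff_le_mono2) simp
      finally show ?thesis .
    qed
  qed
  have "monom 1 N - 1 = monom 1 d ^ t - (1 :: bit poly)"
    by (simp add: N_def monom_power)
  also have "monom 1 d - 1 dvd \<dots>"
    by (metis dvd_triv_left power_diff_1_eq)
  finally have qN: "q dvd monom 1 N - 1" using d(3) dvd_trans by blast
  have periodic: "complex_int_cong (F n a (m + 2 * N)) (F n a m) 2" if m: "m > 2 * (n - r)" for m
  proof -
    obtain f g where f: "F n a m = of_int f" "of_int f = parity_log (fps_of_poly P) $ m"
      and g: "F n a (m + 2 * N) = of_int g" "of_int g = parity_log (fps_of_poly P) $ (m + 2 * N)"
      using F_eq_of_int[of m n a] F_eq_of_int[of "m + 2 * N" n a] m unfolding P_def by auto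
    have "(of_int g :: bit) = of_int f"
      using parity_log_periodic[OF P0 degP, of N m] qN \<open>N \<ge> 1\<close> m f g by (simp add: q_def r_def)
    hence "odd g \<longleftrightarrow> odd f" by (simp add: of_int_bit of_bool_eq_iff)
    hence "[g = f] (mod 2)" unfolding cong_def by presburger
    thus ?thesis by (simp add: f g)
  qed
  have "n - r = 0" if "odd (a n)"
  proof -
    have "coeff q n \<noteq> 0" using that assms by (simp add: coeff_q P_def coeff_char_poly_rev of_int_bit)
    thus ?thesis unfolding r_def by (simp add: le_degree)
  qed
  thus ?thesis
    using periodic bound \<open>N \<ge> 1\<close> \<open>n - r \<le> N\<close> by (intro exI[of _ N]) auto
qed

end
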